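(* Let $\mathcal L$ be a Lie--Jordan Banach algebra (LJB-algebra), let $\mathcal J$ be a closed Jordan ideal of $\mathcal L$, and let $\mathcal N_{\mathcal J}=\{a\in\mathcal L : [a,\mathcal J]\subset\mathcal J\}$ be its normalizer. Then the subspace $\widetilde{\mathcal J}=\mathcal N_{\mathcal J}\cap\mathcal J$ is a closed Lie--Jordan ideal of the LJB-algebra $\mathcal N_{\mathcal J}$.
   Context: A Lie--Jordan algebra is a real vector space $\mathcal L$ with a commutative bilinear product $\circ$ satisfying $(a^2\circ b)\circ a=a^2\circ(b\circ a)$, where $a^2=a\circ a$, and a skew-symmetric bilinear bracket $[\cdot,\cdot]$ satisfying the Jacobi identity, the Leibniz identity $[a,b\circ c]=[a,b]\circ c+b\circ[a,c]$, and the associator identity $(a\circ b)\circ c-a\circ(b\circ c)=k\,[b,[c,a]]$ for some fixed real constant $k>0$. An LJB-algebra is a Lie--Jordan algebra with a complete norm such that $\|a\circ b\|\le\|a\|\,\|b\|$, $\|a\circ a\|=\|a\|^2$, $\|a\circ a\|\le\|a\circ a+b\circ b\|$ for all $a,b$, and such that the bracket is continuous. A Jordan ideal of $\mathcal L$ is a linear subspace $\mathcal J$ with $\mathcal L\circ\mathcal J\subset\mathcal J$. A Lie--Jordan ideal of $\mathcal N$ is a linear subspace $\mathcal I\subset\mathcal N$ with $\mathcal N\circ\mathcal I\subset\mathcal I$ and $[\mathcal N,\mathcal I]\subset\mathcal I$. *)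

theory Defs
  imports "HOL-Analysis.Analysis"
begin

text \<open>
  Algebras live on a linear subspace \<open>L\<close> of an ambient normed space, so that one definition covers
  both an algebra and its subalgebras. The products are total functions on the ambient type, but
  are constrained on \<open>L\<close> only. The norm of an algebra is the restriction of the ambient norm.
\<close>

locale lie_jordan_algebra =
  fixes L :: "'a::real_vector set"
    and jprod :: "'a \<Rightarrow> 'a \<Rightarrow> 'a"  (infixl "\<circ>\<^sub>J" 70)
    and bracket :: "'a \<Rightarrow> 'a \<Rightarrow> 'a"  ("\<lbrakk>_,/ _\<rbrakk>\<^sub>L")
    and k :: real
  assumes subspace_carrier: "subspace L"
    and jprod_closed: "\<lbrakk>a \<in> L; b \<in> L\<rbrakk> \<Longrightarrow> a \<circ>\<^sub>J b \<in> L"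
    and bracket_closed: "\<lbrakk>a \<in> L; b \<in> L\<rbrakk> \<Longrightarrow> \<lbrakk>a, b\<rbrakk>\<^sub>L \<in> L"
    and jprod_add_left: "\<lbrakk>a \<in> L; b \<in> L; c \<in> L\<rbrakk> \<Longrightarrow> (a + b) \<circ>\<^sub>J c = a \<circ>\<^sub>J c + b \<circ>\<^sub>J c"
    and jprod_add_right: "\<lbrakk>a \<in> L; b \<in> L; c \<in> L\<rbrakk> \<Longrightarrow> a \<circ>\<^sub>J (b + c) = a \<circ>\<^sub>J b + a \<circ>\<^sub>J c"
    and jprod_scale_left: "\<lbrakk>a \<in> L; b \<in> L\<rbrakk> \<Longrightarrow> (r *\<^sub>R a) \<circ>\<^sub>J b = r *\<^sub>R (a \<circ>\<^sub>J b)"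
    and jprod_scale_right: "\<lbrakk>a \<in> L; b \<in> L\<rbrakk> \<Longrightarrow> a \<circ>\<^sub>J (r *\<^sub>R b) = r *\<^sub>R (a \<circ>\<^sub>J b)"
    and jprod_commute: "\<lbrakk>a \<in> L; b \<in> L\<rbrakk> \<Longrightarrow> a \<circ>\<^sub>J b = b \<circ>\<^sub>J a"
    and jordan_identity:
      "\<lbrakk>a \<in> L; b \<in> L\<rbrakk> \<Longrightarrow> ((a \<circ>\<^sub>J a) \<circ>\<^sub>J b) \<circ>\<^sub>J a = (a \<circ>\<^sub>J a) \<circ>\<^sub>J (b \<circ>\<^sub>J a)"
    and bracket_add_left: "\<lbrakk>a \<in> L; b \<in> L; c \<in> L\<rbrakk> \<Longrightarrow> \<lbrakk>a + b, c\<rbrakk>\<^sub>L = \<lbrakk>a, c\<rbrakk>\<^sub>L + \<lbrakk>b, c\<rbrakk>\<^sub>L"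
    and bracket_add_right: "\<lbrakk>a \<in> L; b \<in> L; c \<in> L\<rbrakk> \<Longrightarrow> \<lbrakk>a, b + c\<rbrakk>\<^sub>L = \<lbrakk>a, b\<rbrakk>\<^sub>L + \<lbrakk>a, c\<rbrakk>\<^sub>L"
    and bracket_scale_left: "\<lbrakk>a \<in> L; b \<in> L\<rbrakk> \<Longrightarrow> \<lbrakk>r *\<^sub>R a, b\<rbrakk>\<^sub>L = r *\<^sub>R \<lbrakk>a, b\<rbrakk>\<^sub>L"
    and bracket_scale_right: "\<lbrakk>a \<in> L; b \<in> L\<rbrakk> \<Longrightarrow> \<lbrakk>a, r *\<^sub>R b\<rbrakk>\<^sub>L = r *\<^sub>R \<lbrakk>a, b\<rbrakk>\<^sub>L"
    and bracket_skew: "\<lbrakk>a \<in> L; b \<in> L\<rbrakk> \<Longrightarrow> \<lbrakk>a, b\<rbrakk>\<^sub>L = - \<lbrakk>b, a\<rbrakk>\<^sub>L"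
    and jacobi_identity:
      "\<lbrakk>a \<in> L; b \<in> L; c \<in> L\<rbrakk> \<Longrightarrow>
        \<lbrakk>a, \<lbrakk>b, c\<rbrakk>\<^sub>L\<rbrakk>\<^sub>L + \<lbrakk>b, \<lbrakk>c, a\<rbrakk>\<^sub>L\<rbrakk>\<^sub>L + \<lbrakk>c, \<lbrakk>a, b\<rbrakk>\<^sub>L\<rbrakk>\<^sub>L = 0"
    and leibniz_identity:
      "\<lbrakk>a \<in> L; b \<in> L; c \<in> L\<rbrakk> \<Longrightarrow> \<lbrakk>a, b \<circ>\<^sub>J c\<rbrakk>\<^sub>L = \<lbrakk>a, b\<rbrakk>\<^sub>L \<circ>\<^sub>J c + b \<circ>\<^sub>J \<lbrakk>a, c\<rbrakk>\<^sub>L"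
    and associator_constant_pos: "k > 0"
    and associator_identity:
      "\<lbrakk>a \<in> L; b \<in> L; c \<in> L\<rbrakk> \<Longrightarrow>
        (a \<circ>\<^sub>J b) \<circ>\<^sub>J c - a \<circ>\<^sub>J (b \<circ>\<^sub>J c) = k *\<^sub>R \<lbrakk>b, \<lbrakk>c, a\<rbrakk>\<^sub>L\<rbrakk>\<^sub>L"

locale ljb_algebra = lie_jordan_algebra L jprod bracket k
  for L :: "'a::real_normed_vector set"
    and jprod :: "'a \<Rightarrow> 'a \<Rightarrow> 'a"  (infixl "\<circ>\<^sub>J" 70)
    and bracket :: "'a \<Rightarrow> 'a \<Rightarrow> 'a"  ("\<lbrakk>_,/ _\<rbrakk>\<^sub>L")
    and k :: real +
  assumes complete_carrier: "complete L"
    and norm_jprod_le: "\<lbrakk>a \<in> L; b \<in> L\<rbrakk> \<Longrightarrow> norm (a \<circ>\<^sub>J b) \<le> norm a * norm b"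
    and norm_square: "a \<in> L \<Longrightarrow> norm (a \<circ>\<^sub>J a) = (norm a)\<^sup>2"
    and norm_square_le:
      "\<lbrakk>a \<in> L; b \<in> L\<rbrakk> \<Longrightarrow> norm (a \<circ>\<^sub>J a) \<le> norm (a \<circ>\<^sub>J a + b \<circ>\<^sub>J b)"
    and continuous_bracket: "continuous_on (L \<times> L) (\<lambda>(a, b). \<lbrakk>a, b\<rbrakk>\<^sub>L)"

definition jordan_ideal :: "'a::real_vector set \<Rightarrow> ('a \<Rightarrow> 'a \<Rightarrow> 'a) \<Rightarrow> 'a set \<Rightarrow> bool" where
  "jordan_ideal L jprod J \<longleftrightarrow>
    J \<subseteq> L \<and> subspace J \<and> (\<forall>a\<in>L. \<forall>x\<in>J. jprod a x \<in> J)"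

definition lie_jordan_ideal ::
  "'a::real_vector set \<Rightarrow> ('a \<Rightarrow> 'a \<Rightarrow> 'a) \<Rightarrow> ('a \<Rightarrow> 'a \<Rightarrow> 'a) \<Rightarrow> 'a set \<Rightarrow> bool" where
  "lie_jordan_ideal N jprod bracket I \<longleftrightarrow>
    I \<subseteq> N \<and> subspace I \<and>
    (\<forall>a\<in>N. \<forall>x\<in>I. jprod a x \<in> I) \<and> (\<forall>a\<in>N. \<forall>x\<in>I. bracket a x \<in> I)"

definition normalizer :: "'a set \<Rightarrow> ('a \<Rightarrow> 'a \<Rightarrow> 'a) \<Rightarrow> 'a set \<Rightarrow> 'a set" where
  "normalizer L bracket J = {a \<in> L. \<forall>x\<in>J. bracket a x \<in> J}"

end

theory Submission
  imports Defs
begin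

text \<open>Bracketing with a fixed element is a derivation of both products, by the Leibniz and
  Jacobi identities. For a, b in the normalizer N and x in J this writes [a \<circ> b, x] and
  [[a, b], x] through [a, x] and [b, x], which lie in J; since J absorbs products with L and is
  stable under bracketing with a and b, N is closed under both operations
  (\<open>normalizer_jprod_closed\<close>, \<open>normalizer_bracket_closed\<close>). Continuity of
  the bracket makes N closed (\<open>closed_normalizer\<close>), hence complete, and all other
  axioms restrict to N. The ideal property is then immediate: for a in N and x in N \<inter> J, both
  a \<circ> x and [a, x] lie in N because N is a subalgebra, and in J because J is a Jordan ideal
  normalized by a.\<close>

lemma (in lie_jordan_algebra) lie_jordan_algebra_subset:
  assumes "N \<subseteq> L" and "subspace N"
    and "\<And>a b. a \<in> N \<Longrightarrow> b \<in> N \<Longrightarrow> a \<circ>\<^sub>J b \<in> N"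
    and "\<And>a b. a \<in> N \<Longrightarrow> b \<in> N \<Longrightarrow> \<lbrakk>a, b\<rbrakk>\<^sub>L \<in> N"
  shows "lie_jordan_algebra N jprod bracket k"
proof unfold_locales
  have L: "a \<in> L" if "a \<in> N" for a
    using that assms(1) by blast
  show "\<lbrakk>a, b\<rbrakk>\<^sub>L = - \<lbrakk>b, a\<rbrakk>\<^sub>L" if "a \<in> N" "b \<in> N" for a b
    using that by (intro bracket_skew L)
  show "a \<circ>\<^sub>J b = b \<circ>\<^sub>J a" if "a \<in> N" "b \<in> N" for a b
    using that by (intro jprod_commute L)
qed (use assms in \<open>auto simp: jprod_add_left jprod_add_right jprod_scale_left jprod_scale_right
      jordan_identity bracket_add_left bracket_add_right bracket_scale_left bracket_scale_right
      jacobi_identity leibniz_identity associator_constant_pos associator_identity subset_iff\<close>)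

text \<open>The norm conditions and continuity of the bracket pass to any subset; completeness is
  what closedness supplies.\<close>

lemma (in ljb_algebra) ljb_algebra_closed_subset:
  assumes "lie_jordan_algebra N jprod bracket k" and "N \<subseteq> L" and "closed N"
  shows "ljb_algebra N jprod bracket k"
proof (intro ljb_algebra.intro assms(1) ljb_algebra_axioms.intro)
  show "complete N"
    using complete_Int_closed[OF complete_carrier assms(3)] assms(2) by (simp add: Int_absorb1)
  show "continuous_on (N \<times> N) (\<lambda>(a, b). \<lbrakk>a, b\<rbrakk>\<^sub>L)"
    using assms(2) by (intro continuous_on_subset[OF continuous_bracket] Sigma_mono)
qed (use assms(2) norm_jprod_le norm_square norm_square_le in blast)+

text \<open>Up to sign, bracketing with c on the right is the derivation [c, -] of the Leibniz
  identity, and the negative of a derivation is a derivation.\<close>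

lemma (in lie_jordan_algebra) bracket_jprod_left:
  assumes "a \<in> L" "b \<in> L" "c \<in> L"
  shows "\<lbrakk>a \<circ>\<^sub>J b, c\<rbrakk>\<^sub>L = \<lbrakk>a, c\<rbrakk>\<^sub>L \<circ>\<^sub>J b + a \<circ>\<^sub>J \<lbrakk>b, c\<rbrakk>\<^sub>L"
proof -
  have "\<lbrakk>a \<circ>\<^sub>J b, c\<rbrakk>\<^sub>L = - (\<lbrakk>c, a\<rbrakk>\<^sub>L \<circ>\<^sub>J b + a \<circ>\<^sub>J \<lbrakk>c, b\<rbrakk>\<^sub>L)"
    using assms by (simp add: bracket_skew[of "a \<circ>\<^sub>J b" c] jprod_closed leibniz_identity)
  \<comment> \<open>Negation is scaling by -1, so homogeneity moves the sign inside.\<close>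
  also have "\<dots> = (-1) *\<^sub>R \<lbrakk>c, a\<rbrakk>\<^sub>L \<circ>\<^sub>J b + a \<circ>\<^sub>J ((-1) *\<^sub>R \<lbrakk>c, b\<rbrakk>\<^sub>L)"
    using assms by (simp only: jprod_scale_left jprod_scale_right bracket_closed) simp
  also have "\<dots> = \<lbrakk>a, c\<rbrakk>\<^sub>L \<circ>\<^sub>J b + a \<circ>\<^sub>J \<lbrakk>b, c\<rbrakk>\<^sub>L"
    using assms bracket_skew[of a c] bracket_skew[of b c] by simp
  finally show ?thesis .
qed

text \<open>The Jacobi identity in commutator form: on the right, a and b act on c one after the
  other, so that invariance of J under each can be applied in turn.\<close>

lemma (in lie_jordan_algebra) bracket_bracket_left:
  assumes "a \<in> L" "b \<in> L" "c \<in> L"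
  shows "\<lbrakk>\<lbrakk>a, b\<rbrakk>\<^sub>L, c\<rbrakk>\<^sub>L = \<lbrakk>a, \<lbrakk>b, c\<rbrakk>\<^sub>L\<rbrakk>\<^sub>L - \<lbrakk>b, \<lbrakk>a, c\<rbrakk>\<^sub>L\<rbrakk>\<^sub>L"
proof -
  have "\<lbrakk>b, \<lbrakk>c, a\<rbrakk>\<^sub>L\<rbrakk>\<^sub>L = \<lbrakk>b, (-1) *\<^sub>R \<lbrakk>a, c\<rbrakk>\<^sub>L\<rbrakk>\<^sub>L"
    using assms bracket_skew[of c a] by simp
  also have "\<dots> = - \<lbrakk>b, \<lbrakk>a, c\<rbrakk>\<^sub>L\<rbrakk>\<^sub>L"
    using assms by (simp only: bracket_scale_right bracket_closed) simp
  finally have "\<lbrakk>b, \<lbrakk>c, a\<rbrakk>\<^sub>L\<rbrakk>\<^sub>L = - \<lbrakk>b, \<lbrakk>a, c\<rbrakk>\<^sub>L\<rbrakk>\<^sub>L" .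
  moreover have "\<lbrakk>\<lbrakk>a, b\<rbrakk>\<^sub>L, c\<rbrakk>\<^sub>L = - \<lbrakk>c, \<lbrakk>a, b\<rbrakk>\<^sub>L\<rbrakk>\<^sub>L"
    using assms by (intro bracket_skew bracket_closed)
  ultimately show ?thesis
    using jacobi_identity[OF assms] by (simp add: algebra_simps add_eq_0_iff)
qed

lemma (in lie_jordan_algebra) subspace_normalizer:
  assumes "subspace J" and "J \<subseteq> L"
  shows "subspace (normalizer L bracket J)"
proof (rule subspaceI)
  \<comment> \<open>Homogeneity with scalar 0.\<close>
  have "\<lbrakk>0, x\<rbrakk>\<^sub>L = 0" if "x \<in> L" for x
    using bracket_scale_left[of x x 0] that by simp
  then show "0 \<in> normalizer L bracket J"
    using assms subspace_carrier by (auto simp: normalizer_def subspace_0 subset_iff)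
qed (use assms subspace_carrier in
    \<open>auto simp: normalizer_def bracket_add_left bracket_scale_left subspace_add subspace_scale
      subset_iff\<close>)

lemma (in lie_jordan_algebra) normalizer_jprod_closed:
  assumes "jordan_ideal L jprod J"
    and "a \<in> normalizer L bracket J" and "b \<in> normalizer L bracket J"
  shows "a \<circ>\<^sub>J b \<in> normalizer L bracket J"
proof -
  have J: "J \<subseteq> L" "subspace J" and ideal: "\<And>c x. c \<in> L \<Longrightarrow> x \<in> J \<Longrightarrow> c \<circ>\<^sub>J x \<in> J"
    using assms(1) by (auto simp: jordan_ideal_def)
  have ab: "a \<in> L" "b \<in> L" "\<And>x. x \<in> J \<Longrightarrow> \<lbrakk>a, x\<rbrakk>\<^sub>L \<in> J" "\<And>x. x \<in> J \<Longrightarrow> \<lbrakk>b, x\<rbrakk>\<^sub>L \<in> J"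
    using assms(2,3) by (auto simp: normalizer_def)
  have "\<lbrakk>a \<circ>\<^sub>J b, x\<rbrakk>\<^sub>L \<in> J" if "x \<in> J" for x
  proof -
    have x: "x \<in> L"
      using that J by blast
    \<comment> \<open>Each summand is an element of L times an element of J, in the order of the
      ideal condition.\<close>
    have "\<lbrakk>a \<circ>\<^sub>J b, x\<rbrakk>\<^sub>L = b \<circ>\<^sub>J \<lbrakk>a, x\<rbrakk>\<^sub>L + a \<circ>\<^sub>J \<lbrakk>b, x\<rbrakk>\<^sub>L"
      using ab(1,2) x
      by (simp add: bracket_jprod_left bracket_closed jprod_commute[of "\<lbrakk>a, x\<rbrakk>\<^sub>L" b])
    then show ?thesis
      using ab that by (simp add: ideal subspace_add[OF J(2)])
  qed
  then show ?thesis
    using ab by (simp add: normalizer_def jprod_closed)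
qed

lemma (in lie_jordan_algebra) normalizer_bracket_closed:
  assumes "subspace J" and "J \<subseteq> L"
    and "a \<in> normalizer L bracket J" and "b \<in> normalizer L bracket J"
  shows "\<lbrakk>a, b\<rbrakk>\<^sub>L \<in> normalizer L bracket J"
  using assms
  by (auto simp: normalizer_def bracket_closed bracket_bracket_left subspace_diff subset_iff)

text \<open>The normalizer is an intersection of preimages of J under the maps a \<mapsto> [a, x]
  for x in J, each continuous on L as a slice of the jointly continuous bracket.\<close>

lemma (in ljb_algebra) closed_normalizer:
  assumes "closed J" and "J \<subseteq> L"
  shows "closed (normalizer L bracket J)"
proof -
  have L: "closed L"
    by (rule complete_imp_closed[OF complete_carrier])
  have "closed (L \<inter> (\<lambda>a. \<lbrakk>a, x\<rbrakk>\<^sub>L) -` J)" if "x \<in> J" for x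
  proof (rule continuous_closed_preimage[OF _ L assms(1)])
    have "continuous_on L (\<lambda>a. (\<lambda>(a, b). \<lbrakk>a, b\<rbrakk>\<^sub>L) (a, x))"
      by (rule continuous_on_compose2[OF continuous_bracket])
        (use that assms(2) in \<open>auto intro!: continuous_intros\<close>)
    then show "continuous_on L (\<lambda>a. \<lbrakk>a, x\<rbrakk>\<^sub>L)"
      by simp
  qed
  \<comment> \<open>The outer \<open>L\<close> makes the formula right also for empty
    \<open>J\<close>, where the inner intersection is the whole space.\<close>
  then have "closed (L \<inter> (\<Inter>x\<in>J. L \<inter> (\<lambda>a. \<lbrakk>a, x\<rbrakk>\<^sub>L) -` J))"
    by (intro closed_Int L closed_INT) auto
  moreover have "normalizer L bracket J = L \<inter> (\<Inter>x\<in>J. L \<inter> (\<lambda>a. \<lbrakk>a, x\<rbrakk>\<^sub>L) -` J)"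
    by (auto simp: normalizer_def)
  ultimately show ?thesis
    by simp
qed

theorem lemma5:
  fixes L J :: "'a::real_normed_vector set"
    and jprod bracket :: "'a \<Rightarrow> 'a \<Rightarrow> 'a"
    and k :: real
  assumes "ljb_algebra L jprod bracket k"
    and "jordan_ideal L jprod J"
    and "closedin (top_of_set L) J"
  defines "N \<equiv> normalizer L bracket J"
  shows "ljb_algebra N jprod bracket k
    \<and> lie_jordan_ideal N jprod bracket (N \<inter> J)
    \<and> closedin (top_of_set N) (N \<inter> J)"
proof -
  interpret ljb_algebra L jprod bracket k
    by (fact assms(1))
  have J: "J \<subseteq> L" "subspace J" and ideal: "\<And>a x. a \<in> L \<Longrightarrow> x \<in> J \<Longrightarrow> jprod a x \<in> J"
    using assms(2) by (auto simp: jordan_ideal_def)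
  \<comment> \<open>A complete \<open>L\<close> is closed in the ambient space, so closedness
    relative to \<open>L\<close> is absolute.\<close>
  have closed_J: "closed J"
    using closedin_closed_trans[OF assms(3) complete_imp_closed[OF complete_carrier]] .
  have N: "N \<subseteq> L" "\<And>a x. a \<in> N \<Longrightarrow> x \<in> J \<Longrightarrow> bracket a x \<in> J"
    by (auto simp: N_def normalizer_def)
  have subspace_N: "subspace N"
    unfolding N_def using J by (intro subspace_normalizer)
  have jprod_N: "jprod a b \<in> N" if "a \<in> N" "b \<in> N" for a b
    using normalizer_jprod_closed[OF assms(2)] that by (simp add: N_def)
  have bracket_N: "bracket a b \<in> N" if "a \<in> N" "b \<in> N" for a b
    using normalizer_bracket_closed[OF J(2,1)] that by (simp add: N_def)
  have "lie_jordan_algebra N jprod bracket k"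
    by (intro lie_jordan_algebra_subset N(1) subspace_N jprod_N bracket_N)
  moreover have "closed N"
    unfolding N_def by (rule closed_normalizer[OF closed_J J(1)])
  ultimately have "ljb_algebra N jprod bracket k"
    by (intro ljb_algebra_closed_subset N(1))
  moreover have "lie_jordan_ideal N jprod bracket (N \<inter> J)"
    using N ideal jprod_N bracket_N subspace_inter[OF subspace_N J(2)]
    by (auto simp: lie_jordan_ideal_def)
  moreover have "closedin (top_of_set N) (N \<inter> J)"
    using closed_J by (rule closedin_closed_Int)
  ultimately show ?thesis
    by blast
qed

end
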